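(* There exists a family of Boolean functions $\{f_k:\{0,1\}^{n_k}\to\{0,1\} \mid k\in\mathbb{N}\}$ such that for every $k$, $$\mathsf{alt}(f_k)\ge 2^{\mathsf{s}(f_k)}-1 \quad\text{and}\quad \mathsf{alt}(f_k)\ge 2^{(\log_2 \mathsf{sparsity}(f_k))/2}-1.$$
   Context: For $x,y\in\{0,1\}^n$ write $x\prec y$ if $x_i\le y_i$ for all $i$. A chain is a sequence of distinct inputs $0^n=x_0\prec x_1\prec\dots\prec x_n=1^n$ (so consecutive elements differ in exactly one coordinate). For a chain $\mathcal C$, $\mathsf{alt}(f,\mathcal C)=|\{i\in[n]: f(x_{i-1})\ne f(x_i)\}|$, and the alternation $\mathsf{alt}(f)$ is the maximum of $\mathsf{alt}(f,\mathcal C)$ over all chains. The sensitivity of $f$ at $x$ is $\mathsf{s}(f,x)=|\{i\in[n]: f(x\oplus e_i)\ne f(x)\}|$, where $e_i$ is the $i$-th unit vector, and $\mathsf{s}(f)=\max_x \mathsf{s}(f,x)$. For $g:\{0,1\}^n\to\{-1,1\}$ with Fourier expansion $g=\sum_{S\subseteq[n]}\hat g(S)\chi_S$, $\chi_S(x)=(-1)^{\sum_{i\in S}x_i}$, $\mathsf{sparsity}(g)$ is the number of $S$ with $\hat g(S)\neq 0$; for $f$ with range $\{0,1\}$, $\mathsf{sparsity}(f):=\mathsf{sparsity}(1-2f)$. *)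

theory Defs
  imports Complex_Main
begin

definition cube :: "nat \<Rightarrow> bool list set" where
  "cube n = {x. length x = n}"

definition le_cube :: "bool list \<Rightarrow> bool list \<Rightarrow> bool"  (infix "\<preceq>" 50) where
  "x \<preceq> y \<longleftrightarrow> list_all2 (\<le>) x y"

definition is_chain :: "nat \<Rightarrow> (nat \<Rightarrow> bool list) \<Rightarrow> bool" where
  "is_chain n c \<longleftrightarrow>
     (\<forall>i\<le>n. c i \<in> cube n) \<and> inj_on c {0..n} \<and>
     c 0 = replicate n False \<and> c n = replicate n True \<and>
     (\<forall>i<n. c i \<preceq> c (Suc i))"

text \<open>A Boolean function on the \<open>n\<close>-cube is a predicate \<open>f :: bool list \<Rightarrow> bool\<close> of which
  only the values on \<^term>\<open>cube n\<close> matter.\<close>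

definition alt_chain :: "nat \<Rightarrow> (bool list \<Rightarrow> bool) \<Rightarrow> (nat \<Rightarrow> bool list) \<Rightarrow> nat" where
  "alt_chain n f c = card {i \<in> {1..n}. f (c (i - 1)) \<noteq> f (c i)}"

definition alt :: "nat \<Rightarrow> (bool list \<Rightarrow> bool) \<Rightarrow> nat" where
  "alt n f = Max {alt_chain n f c | c. is_chain n c}"

definition flip :: "bool list \<Rightarrow> nat \<Rightarrow> bool list" where
  "flip x i = x[i := \<not> x ! i]"

definition sens_at :: "nat \<Rightarrow> (bool list \<Rightarrow> bool) \<Rightarrow> bool list \<Rightarrow> nat" where
  "sens_at n f x = card {i \<in> {..<n}. f (flip x i) \<noteq> f x}"

definition sens :: "nat \<Rightarrow> (bool list \<Rightarrow> bool) \<Rightarrow> nat" where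
  "sens n f = Max (sens_at n f ` cube n)"

definition character :: "nat set \<Rightarrow> bool list \<Rightarrow> real" where
  "character S x = (- 1) ^ (\<Sum>i\<in>S. of_bool (x ! i))"

definition fourier_coeff :: "nat \<Rightarrow> (bool list \<Rightarrow> real) \<Rightarrow> nat set \<Rightarrow> real" where
  "fourier_coeff n g S = (\<Sum>x\<in>cube n. g x * character S x) / 2 ^ n"

definition sparsity :: "nat \<Rightarrow> (bool list \<Rightarrow> real) \<Rightarrow> nat" where
  "sparsity n g = card {S. S \<subseteq> {..<n} \<and> fourier_coeff n g S \<noteq> 0}"

definition sparsity_bool :: "nat \<Rightarrow> (bool list \<Rightarrow> bool) \<Rightarrow> nat" where
  "sparsity_bool n f = sparsity n (\<lambda>x. 1 - 2 * of_bool (f x))"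

lemma finite_cube: "finite (cube n)"
  using finite_lists_length_eq[of "UNIV :: bool set" n] by (simp add: cube_def)

lemma character_prod: "finite S \<Longrightarrow> character S x = (\<Prod>i\<in>S. if x ! i then - 1 else 1)"
  unfolding character_def power_sum by (intro prod.cong) auto

lemma sum_character_mult:
  assumes "x \<in> cube n" "y \<in> cube n"
  shows "(\<Sum>S\<in>Pow {..<n}. character S x * character S y) = (if x = y then 2 ^ n else 0)"
proof -
  have "(\<Sum>S\<in>Pow {..<n}. character S x * character S y)
      = (\<Sum>S\<in>Pow {..<n}. \<Prod>i\<in>S. (if x ! i = y ! i then 1 else - 1 :: real))"
    by (intro sum.cong refl)
       (auto simp: character_prod finite_subset simp flip: prod.distrib intro!: prod.cong)
  also have "\<dots> = (\<Prod>i<n. (if x ! i = y ! i then 1 else - 1) + 1)"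
    by (subst prod_add) auto
  also have "\<dots> = (if x = y then 2 ^ n else 0)"
  proof (cases "x = y")
    case False
    then obtain i where "i < n" "x ! i \<noteq> y ! i"
      using assms by (auto simp: cube_def list_eq_iff_nth_eq)
    then show ?thesis using False by (auto intro!: prod_zero)
  qed auto
  finally show ?thesis .
qed

lemma fourier_expansion:
  assumes "x \<in> cube n"
  shows "g x = (\<Sum>S\<in>Pow {..<n}. fourier_coeff n g S * character S x)"
proof -
  have "(\<Sum>S\<in>Pow {..<n}. fourier_coeff n g S * character S x)
      = (\<Sum>S\<in>Pow {..<n}. \<Sum>y\<in>cube n. g y / 2 ^ n * (character S x * character S y))"
    by (intro sum.cong refl)
       (simp add: fourier_coeff_def sum_divide_distrib sum_distrib_right sum_distrib_left mult_ac)
  also have "\<dots> = (\<Sum>y\<in>cube n. g y / 2 ^ n * (\<Sum>S\<in>Pow {..<n}. character S x * character S y))"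
    by (subst sum.swap) (simp add: sum_distrib_left)
  also have "\<dots> = (\<Sum>y\<in>cube n. if x = y then g y else 0)"
    by (intro sum.cong refl) (simp add: sum_character_mult assms)
  also have "\<dots> = g x" using assms by (simp add: finite_cube)
  finally show ?thesis by simp
qed

lemma alt_chain_le: "alt_chain n f c \<le> n"
proof -
  have "alt_chain n f c \<le> card {1..n}"
    unfolding alt_chain_def by (rule card_mono) auto
  then show ?thesis by simp
qed

lemma is_chain_exists: "is_chain n (\<lambda>i. replicate i True @ replicate (n - i) False)"
proof -
  let ?c = "\<lambda>i. replicate i True @ replicate (n - i) False"
  have "inj_on ?c {0..n}"
  proof (rule inj_onI)
    fix i j assume "?c i = ?c j"
    then have "length (filter id (?c i)) = length (filter id (?c j))" by simp
    then show "i = j" by simp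
  qed
  then show ?thesis
    by (auto simp: is_chain_def cube_def le_cube_def list_all2_conv_all_nth nth_append nth_Cons')
qed

lemma alt_set_finite_nonempty:
  "finite {alt_chain n f c | c. is_chain n c}" "{alt_chain n f c | c. is_chain n c} \<noteq> {}"
proof -
  show "finite {alt_chain n f c | c. is_chain n c}"
    by (rule finite_subset[of _ "{..n}"]) (auto simp: alt_chain_le)
  show "{alt_chain n f c | c. is_chain n c} \<noteq> {}"
    using is_chain_exists[of n] by blast
qed

end

theory Submission imports Defs begin

text \<open>
  Binary search on the monotone inputs \<open>1\<^sup>i0\<^sup>n\<^sup>-\<^sup>i\<close>, where \<open>n = 2\<^sup>k - 1\<close>, finds \<open>i\<close> with \<open>k\<close>
  queries. Run on arbitrary inputs and answering the parity of the leaf that is reached, it is a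
  decision tree of depth \<open>k\<close> whose function changes its value \<open>n\<close> times along the chain of
  monotone inputs. On the other hand, the sensitivity of a decision tree is at most its depth \<open>k\<close>,
  and by \<open>g = (1 + \<chi>\<^sub>i) / 2 \<cdot> g\<^sub>0 + (1 - \<chi>\<^sub>i) / 2 \<cdot> g\<^sub>1\<close> for a tree that queries \<open>i\<close> first, its sparsity
  is at most \<open>4\<^sup>k\<close>.
\<close>

datatype dtree = Leaf bool | Node nat dtree dtree

primrec eval_tree :: "dtree \<Rightarrow> bool list \<Rightarrow> bool" where
  "eval_tree (Leaf b) x = b"
| "eval_tree (Node i l r) x = (if x ! i then eval_tree r x else eval_tree l x)"

primrec depth :: "dtree \<Rightarrow> nat" where
  "depth (Leaf b) = 0"
| "depth (Node i l r) = Suc (max (depth l) (depth r))"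

primrec vars :: "dtree \<Rightarrow> nat set" where
  "vars (Leaf b) = {}"
| "vars (Node i l r) = insert i (vars l \<union> vars r)"

primrec queried :: "dtree \<Rightarrow> bool list \<Rightarrow> nat set" where
  "queried (Leaf b) x = {}"
| "queried (Node i l r) x = insert i (if x ! i then queried r x else queried l x)"

lemma card_queried_le: "finite (queried t x) \<and> card (queried t x) \<le> depth t"
  by (induction t) (auto simp: card_insert_if)

text \<open>Flipping a coordinate off the path of \<open>x\<close> changes no answer along that
  path, so the same leaf is reached. Hence all sensitive coordinates at \<open>x\<close> lie in
  \<open>queried t x\<close>.\<close>

lemma eval_tree_flip: "j \<notin> queried t x \<Longrightarrow> eval_tree t (flip x j) = eval_tree t x"
  by (induction t) (auto simp: flip_def split: if_splits)

lemma sens_eval_tree_le: "sens n (eval_tree t) \<le> depth t"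
proof -
  have "sens_at n (eval_tree t) x \<le> depth t" for x
  proof -
    have "sens_at n (eval_tree t) x \<le> card (queried t x)"
      unfolding sens_at_def
      by (rule card_mono) (use card_queried_le eval_tree_flip in blast)+
    then show ?thesis using card_queried_le[of t x] by linarith
  qed
  moreover have "cube n \<noteq> {}"
    unfolding cube_def by (auto intro: exI[of _ "replicate n False"])
  ultimately show ?thesis
    unfolding sens_def by (subst Max_le_iff) (auto simp: finite_cube)
qed

text \<open>Symmetric difference with \<open>{i}\<close>: the effect on index sets of multiplying by
  the character of \<open>{i}\<close>.\<close>

definition toggle :: "nat \<Rightarrow> nat set \<Rightarrow> nat set" where
  "toggle i S = (if i \<in> S then S - {i} else insert i S)"

lemma toggle_toggle [simp]: "toggle i (toggle i S) = S"
  by (auto simp: toggle_def)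

lemma character_toggle:
  assumes "finite S"
  shows "character (toggle i S) x = (if x ! i then - 1 else 1) * character S x"
proof (cases "i \<in> S")
  case True
  then show ?thesis
    using assms by (simp add: toggle_def character_prod prod.remove[of S i])
next
  case False
  then show ?thesis using assms by (simp add: toggle_def character_prod)
qed

lemma character_flip:
  assumes "finite S" "i \<in> S" "i < length x"
  shows "character S (flip x i) = - character S x"
proof -
  have "(\<Prod>j\<in>S - {i}. if flip x i ! j then - 1 else 1 :: real)
      = (\<Prod>j\<in>S - {i}. if x ! j then - 1 else 1)"
    by (rule prod.cong) (auto simp: flip_def)
  then show ?thesis
    using assms by (simp add: character_prod prod.remove[of S i]) (simp add: flip_def)
qed

lemma fourier_coeff_const:
  assumes "S \<subseteq> {..<n}" "S \<noteq> {}"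
  shows "fourier_coeff n (\<lambda>x. c) S = 0"
proof -
  obtain i where i: "i \<in> S" "i < n" using assms by auto
  have fin: "finite S" using assms finite_subset by blast
  \<comment> \<open>Pairing \<open>x\<close> with \<open>flip x i\<close> for some \<open>i\<close>
    in \<open>S\<close> shows that the sum equals its own negative.\<close>
  have "(\<Sum>x\<in>cube n. character S x) = (\<Sum>x\<in>cube n. character S (flip x i))"
    by (rule sum.reindex_bij_witness[of _ "\<lambda>x. flip x i" "\<lambda>x. flip x i"])
       (use i in \<open>auto simp: flip_def cube_def\<close>)
  also have "\<dots> = (\<Sum>x\<in>cube n. - character S x)"
    by (rule sum.cong) (use i fin in \<open>auto simp: cube_def character_flip\<close>)
  finally have "(\<Sum>x\<in>cube n. character S x) = 0" by (simp add: sum_negf)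
  then show ?thesis by (simp add: fourier_coeff_def flip: sum_distrib_left)
qed

text \<open>The indicators of the two branches are half the sum and half the difference of 1 and the
  character of \<open>{i}\<close>; multiplying by that character moves the coefficient at
  \<open>toggle i S\<close> to \<open>S\<close>.\<close>

lemma fourier_coeff_branch:
  assumes "finite S"
  shows "fourier_coeff n (\<lambda>x. if x ! i then h x else g x) S
       = (fourier_coeff n g S + fourier_coeff n g (toggle i S)
          + fourier_coeff n h S - fourier_coeff n h (toggle i S)) / 2"
proof -
  have "(\<Sum>x\<in>cube n. (if x ! i then h x else g x) * character S x)
      = (\<Sum>x\<in>cube n. (g x * character S x + g x * character (toggle i S) x
          + h x * character S x - h x * character (toggle i S) x) / 2)"
    by (rule sum.cong) (auto simp: character_toggle assms)
  then show ?thesis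
    by (simp add: fourier_coeff_def sum.distrib sum_subtractf add_divide_distrib
        diff_divide_distrib flip: sum_divide_distrib)
qed

text \<open>A superset of the Fourier support, following the branch formula: \<open>S\<close> can
  occur only if \<open>S\<close> or \<open>toggle i S\<close> occurs in one of the subtrees.\<close>

primrec spectrum_bound :: "dtree \<Rightarrow> nat set set" where
  "spectrum_bound (Leaf b) = {{}}"
| "spectrum_bound (Node i l r) =
     (spectrum_bound l \<union> spectrum_bound r) \<union> toggle i ` (spectrum_bound l \<union> spectrum_bound r)"

lemma finite_spectrum_bound: "finite (spectrum_bound t)"
  by (induction t) auto

text \<open>Uniting the two subtrees and adding the toggled copy each cost at most a factor 2 per
  level.\<close>

lemma card_spectrum_bound: "card (spectrum_bound t) \<le> 4 ^ depth t"
proof (induction t)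
  case (Node i l r)
  let ?U = "spectrum_bound l \<union> spectrum_bound r" and ?m = "max (depth l) (depth r)"
  have "card (spectrum_bound (Node i l r)) \<le> card ?U + card (toggle i ` ?U)"
    unfolding spectrum_bound.simps by (rule card_Un_le)
  moreover have "card (toggle i ` ?U) \<le> card ?U"
    by (rule card_image_le) (simp add: finite_spectrum_bound)
  moreover have "card ?U \<le> card (spectrum_bound l) + card (spectrum_bound r)"
    by (rule card_Un_le)
  moreover have "(4::nat) ^ depth l \<le> 4 ^ ?m" "(4::nat) ^ depth r \<le> 4 ^ ?m"
    by (auto intro: power_increasing)
  ultimately show ?case
    using Node.IH unfolding depth.simps power_Suc by linarith
qed simp

lemma fourier_coeff_eval_tree:
  assumes "vars t \<subseteq> {..<n}" "S \<subseteq> {..<n}" "S \<notin> spectrum_bound t"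
  shows "fourier_coeff n (\<lambda>x. 1 - 2 * of_bool (eval_tree t x)) S = 0"
  using assms
proof (induction t arbitrary: S)
  case (Leaf b)
  then show ?case by (simp add: fourier_coeff_const)
next
  case (Node i l r)
  have fin: "finite S" using Node.prems(2) finite_subset by blast
  have "toggle i S \<subseteq> {..<n}"
    using Node.prems by (auto simp: toggle_def)
  \<comment> \<open>Since \<open>toggle i\<close> is an involution, \<open>S\<close> would otherwise
    lie in the toggled half. So all four coefficients in the branch formula vanish by
    induction.\<close>
  moreover have "toggle i S \<notin> spectrum_bound l \<union> spectrum_bound r"
  proof
    assume "toggle i S \<in> spectrum_bound l \<union> spectrum_bound r"
    then have "toggle i (toggle i S) \<in> toggle i ` (spectrum_bound l \<union> spectrum_bound r)"
      by (rule imageI)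
    then show False using Node.prems(3) by simp
  qed
  moreover have "(\<lambda>x. 1 - 2 * of_bool (eval_tree (Node i l r) x) :: real)
      = (\<lambda>x. if x ! i then 1 - 2 * of_bool (eval_tree r x) else 1 - 2 * of_bool (eval_tree l x))"
    by auto
  ultimately show ?case
    using Node by (simp add: fourier_coeff_branch[OF fin])
qed

lemma sparsity_eval_tree_le:
  assumes "vars t \<subseteq> {..<n}"
  shows "sparsity_bool n (eval_tree t) \<le> 4 ^ depth t"
proof -
  have "sparsity_bool n (eval_tree t) \<le> card (spectrum_bound t)"
    unfolding sparsity_bool_def sparsity_def
    by (rule card_mono[OF finite_spectrum_bound]) (use fourier_coeff_eval_tree assms in blast)
  then show ?thesis using card_spectrum_bound[of t] by linarith
qed

text \<open>The tree \<open>search_tree k a\<close> searches for \<open>i\<close> in \<open>{a..<a + 2\<^sup>k}\<close>.\<close>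

primrec search_tree :: "nat \<Rightarrow> nat \<Rightarrow> dtree" where
  "search_tree 0 a = Leaf (odd a)"
| "search_tree (Suc k) a = Node (a + 2 ^ k - 1) (search_tree k a) (search_tree k (a + 2 ^ k))"

lemma depth_search_tree [simp]: "depth (search_tree k a) = k"
  by (induction k arbitrary: a) auto

text \<open>The monotone inputs are indexed by \<open>0..n\<close>, hence the bound
  \<open>Suc n\<close> on the interval, while the queried positions stay below
  \<open>n\<close>.\<close>

lemma vars_search_tree: "a + 2 ^ k \<le> Suc n \<Longrightarrow> vars (search_tree k a) \<subseteq> {..<n}"
proof (induction k arbitrary: a)
  case (Suc k)
  have "(0::nat) < 2 ^ k" by simp
  then have "a + 2 ^ k - 1 < n" using Suc.prems unfolding power_Suc by linarith
  then show ?case using Suc.IH[of a] Suc.IH[of "a + 2 ^ k"] Suc.prems by simp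
qed simp

lemma eval_search_tree:
  assumes "a \<le> i" "i < a + 2 ^ k" "a + 2 ^ k \<le> Suc n"
  shows "eval_tree (search_tree k a) (replicate i True @ replicate (n - i) False) = odd i"
  using assms
proof (induction k arbitrary: a)
  case 0
  then have "a = i" by simp
  then show ?case by simp
next
  case (Suc k)
  have pos: "(0::nat) < 2 ^ k" by simp
  then have "a + 2 ^ k - 1 < n" using Suc.prems unfolding power_Suc by linarith
  \<comment> \<open>Positions count from 0, so the queried bit tells whether \<open>i\<close> has
    reached \<open>a + 2 ^ k\<close>, the start of the right half.\<close>
  then have "(replicate i True @ replicate (n - i) False) ! (a + 2 ^ k - 1) \<longleftrightarrow> a + 2 ^ k - 1 < i"
    by (simp add: nth_append)
  also have "\<dots> \<longleftrightarrow> a + 2 ^ k \<le> i" using pos by linarith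
  finally show ?case
    using Suc.IH[of a] Suc.IH[of "a + 2 ^ k"] Suc.prems by auto
qed

lemma alt_search_tree_ge: "2 ^ k - 1 \<le> alt (2 ^ k - 1) (eval_tree (search_tree k 0))"
proof -
  define n :: nat where "n = 2 ^ k - 1"
  let ?f = "eval_tree (search_tree k 0)"
  let ?c = "\<lambda>i. replicate i True @ replicate (n - i) False"
  have n: "Suc n = 2 ^ k" by (simp add: n_def)
  have val: "?f (?c i) = odd i" if "i \<le> n" for i
    using eval_search_tree[of 0 i k n] that n by simp
  have "?f (?c (i - 1)) \<noteq> ?f (?c i)" if "i \<in> {1..n}" for i
    using that val[of i] val[of "i - 1"] by (cases i) auto
  then have "{i \<in> {1..n}. ?f (?c (i - 1)) \<noteq> ?f (?c i)} = {1..n}" by blast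
  then have "alt_chain n ?f ?c = n" by (simp add: alt_chain_def)
  moreover have "alt_chain n ?f ?c \<le> alt n ?f"
    unfolding alt_def
    by (rule Max_ge[OF alt_set_finite_nonempty(1)]) (use is_chain_exists in blast)
  ultimately show ?thesis by (simp add: n_def)
qed

lemma powr_half_log_le:
  fixes s k :: nat
  assumes "s \<le> 4 ^ k"
  shows "2 powr (log 2 (real s) / 2) \<le> 2 ^ k"
proof (cases "s = 0")
  case False
  have "real s \<le> 4 ^ k" using assms by (metis of_nat_le_iff of_nat_numeral of_nat_power)
  also have "(4::real) ^ k = 2 powr (2 * real k)"
    by (simp add: powr_realpow[symmetric] powr_powr[symmetric])
  finally have "log 2 (real s) \<le> 2 * real k"
    using False by (simp add: log_le_iff)
  then have "2 powr (log 2 (real s) / 2) \<le> 2 powr real k"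
    by (intro powr_mono) auto
  then show ?thesis by (simp add: powr_realpow)
\<comment> \<open>For \<open>s = 0\<close> the convention \<open>ln 0 = 0\<close> makes the left
  side \<open>2 powr 0 = 1\<close>.\<close>
qed (simp add: log_def)

theorem theorem1:
  "\<exists>(n :: nat \<Rightarrow> nat) (f :: nat \<Rightarrow> bool list \<Rightarrow> bool).
     filterlim (\<lambda>k. alt (n k) (f k)) at_top at_top \<and>
     (\<forall>k. real (alt (n k) (f k)) \<ge> 2 ^ sens (n k) (f k) - 1 \<and>
          real (alt (n k) (f k)) \<ge> 2 powr (log 2 (real (sparsity_bool (n k) (f k))) / 2) - 1)"
proof -
  define n :: "nat \<Rightarrow> nat" where "n k = 2 ^ k - 1" for k
  define f where "f k = eval_tree (search_tree k 0)" for k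
  have alt: "2 ^ k - 1 \<le> alt (n k) (f k)" for k
    using alt_search_tree_ge by (simp add: n_def f_def)
  \<comment> \<open>This form avoids truncated subtraction when passing to the reals.\<close>
  have "2 ^ k \<le> Suc (alt (n k) (f k))" for k using alt[of k] by linarith
  then have real_alt: "2 ^ k - 1 \<le> real (alt (n k) (f k))" for k
    by (metis of_nat_le_iff of_nat_numeral of_nat_power of_nat_Suc diff_le_eq add.commute)
  \<comment> \<open>Unbounded alternation excludes trivial families such as constant functions; it
    follows from \<open>k < 2 ^ k\<close>.\<close>
  have "k \<le> alt (n k) (f k)" for k
    using alt[of k] less_exp[of k] by linarith
  then have "filterlim (\<lambda>k. alt (n k) (f k)) at_top at_top"
    by (intro filterlim_at_top_mono[OF filterlim_ident]) auto
  moreover have "(2::real) ^ sens (n k) (f k) \<le> 2 ^ k" for k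
    using sens_eval_tree_le[of "n k" "search_tree k 0"] by (simp add: f_def)
  moreover have "2 powr (log 2 (real (sparsity_bool (n k) (f k))) / 2) \<le> 2 ^ k" for k
    using sparsity_eval_tree_le[OF vars_search_tree[of 0 k "n k"]]
    by (intro powr_half_log_le) (simp add: f_def n_def)
  ultimately show ?thesis
    using real_alt by (intro exI[of _ n] exI[of _ f]) (smt (verit))
qed

end
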